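(* Let $X=(X_1,\ldots,X_N)$ be a family of independent random variables with $X_k\in\{0,1\}$ and $p_k=\mathbb{P}(X_k=1)$. Assume that for the function $f:\{0,1\}^N\to\mathbb{R}$ there are numbers $(c_k)_{k\in[N]}$ such that whenever $x,\tilde x\in\{0,1\}^N$ differ only in the $k$-th coordinate we have $|f(x)-f(\tilde x)|\le c_k$. Let $\mu=\mathbb{E}f(X)$ and $C=\max_{k\in[N]}c_k$. For any $t\ge0$ we have $$\mathbb{P}(f(X)\ge\mu+t)\le\exp\left(-\frac{t^2}{2\sum_{k\in[N]}(1-p_k)p_kc_k^2+2Ct/3}\right).$$
   Context: $[N]=\{1,\ldots,N\}$. *)

theory Defs
  imports "HOL-Probability.Probability"
begin

text \<open>
  The set of all 0-1 vectors indexed by \<open>{1..N}\<close>. Its elements are extensional functions, so a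
  function on the cube cannot depend on values at indices outside \<open>{1..N}\<close>.
\<close>
definition binary_cube :: "nat \<Rightarrow> (nat \<Rightarrow> real) set" where
  "binary_cube N = (\<Pi>\<^sub>E k\<in>{1..N}. {0, 1})"

definition differ_only_at :: "nat \<Rightarrow> nat \<Rightarrow> (nat \<Rightarrow> real) \<Rightarrow> (nat \<Rightarrow> real) \<Rightarrow> bool" where
  "differ_only_at N k x y \<longleftrightarrow> {j \<in> {1..N}. x j \<noteq> y j} = {k}"

definition random_vector :: "nat \<Rightarrow> (nat \<Rightarrow> 'a \<Rightarrow> real) \<Rightarrow> 'a \<Rightarrow> (nat \<Rightarrow> real)" where
  "random_vector N X \<omega> = (\<lambda>k\<in>{1..N}. X k \<omega>)"

end

theory Submission imports Defs begin

text \<open>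
  The Chernoff method: averaging out one coordinate at a time replaces \<open>f\<close> by a function of fewer
  coordinates with the same oscillations \<open>c k\<close>, at the cost of a factor
  \<open>exp (p k * (1 - p k) * (c k)\<^sup>2 * l\<^sup>2 / (2 * (1 - l * C / 3)))\<close> in the exponential moment
  of parameter \<open>l\<close>. With \<open>V\<close> the sum of the variances, the optimal parameter is
  \<open>l = t / (V + C * t / 3)\<close>.
\<close>

section \<open>Quadratic bounds for the exponential and for two-point laws\<close>

text \<open>The right side minus the left vanishes at \<open>0\<close> and has derivative
  \<open>1 + x - exp x\<close>, which is never positive; so it is nonnegative to the left of
  \<open>0\<close>.\<close>

lemma exp_le_quadratic_nonpos:
  fixes y :: real
  assumes "y \<le> 0"
  shows "exp y \<le> 1 + y + y\<^sup>2 / 2"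
proof -
  have "1 + 0 + 0\<^sup>2 / 2 - exp 0 \<le> 1 + y + y\<^sup>2 / 2 - exp y"
  proof (rule DERIV_nonpos_imp_nonincreasing[OF assms])
    fix x :: real
    have "((\<lambda>y. 1 + y + y\<^sup>2 / 2 - exp y) has_real_derivative 1 + x - exp x) (at x)"
      by (auto intro!: derivative_eq_intros)
    moreover have "1 + x - exp x \<le> 0" by (simp add: exp_ge_add_one_self)
    ultimately show "\<exists>d. ((\<lambda>y. 1 + y + y\<^sup>2 / 2 - exp y) has_real_derivative d) (at x) \<and> d \<le> 0"
      by blast
  qed
  then show ?thesis by simp
qed

text \<open>For \<open>y < 3\<close> this bounds \<open>exp y\<close> by its Pade approximant with
  quadratic numerator and linear denominator. With the denominator cleared, the difference of the
  sides vanishes at \<open>0\<close>, as does its derivative, treated in \<open>d1\<close>;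
  differentiating once more reduces the sign to \<open>1 - x \<le> exp (- x)\<close>.\<close>

lemma exp_mult_le_quadratic_nonneg:
  fixes y :: real
  assumes "0 \<le> y"
  shows "(6 - 2 * y) * exp y \<le> 6 + 4 * y + y\<^sup>2"
proof -
  have d1: "0 \<le> 4 + 2 * y - (4 - 2 * y) * exp y" if "0 \<le> y" for y :: real
  proof -
    have "4 + 2 * 0 - (4 - 2 * 0) * exp 0 \<le> 4 + 2 * y - (4 - 2 * y) * exp y"
    proof (rule DERIV_nonneg_imp_nondecreasing[OF that])
      fix x :: real
      have "((\<lambda>y. 4 + 2 * y - (4 - 2 * y) * exp y) has_real_derivative
          2 - 2 * ((1 - x) * exp x)) (at x)"
        by (auto intro!: derivative_eq_intros simp: algebra_simps)
      moreover have "(1 - x) * exp x \<le> exp (- x) * exp x"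
        using exp_ge_add_one_self[of "- x"] by (intro mult_right_mono) auto
      then have "0 \<le> 2 - 2 * ((1 - x) * exp x)" by (simp add: exp_minus)
      ultimately show "\<exists>d. ((\<lambda>y. 4 + 2 * y - (4 - 2 * y) * exp y) has_real_derivative d) (at x)
          \<and> 0 \<le> d" by blast
    qed
    then show ?thesis by simp
  qed
  have "6 + 4 * 0 + 0\<^sup>2 - (6 - 2 * 0) * exp 0 \<le> 6 + 4 * y + y\<^sup>2 - (6 - 2 * y) * exp y"
  proof (rule DERIV_nonneg_imp_nondecreasing[OF assms])
    fix x :: real
    assume "0 \<le> x"
    have "((\<lambda>y. 6 + 4 * y + y\<^sup>2 - (6 - 2 * y) * exp y) has_real_derivative
        4 + 2 * x - (4 - 2 * x) * exp x) (at x)"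
      by (auto intro!: derivative_eq_intros simp: algebra_simps)
    with d1[OF \<open>0 \<le> x\<close>]
    show "\<exists>d. ((\<lambda>y. 6 + 4 * y + y\<^sup>2 - (6 - 2 * y) * exp y) has_real_derivative d) (at x) \<and> 0 \<le> d"
      by blast
  qed
  then show ?thesis by simp
qed

text \<open>For \<open>y \<le> 0\<close> the quadratic Taylor bound suffices, because
  \<open>1 - s / 3\<close> lies between \<open>0\<close> and \<open>1\<close>. For
  \<open>y > 0\<close> the Pade approximant is exactly the right side with \<open>y\<close> in place
  of \<open>s\<close>, and raising \<open>y\<close> to \<open>s\<close> only increases it.\<close>

lemma exp_le_bernstein:
  fixes y s :: real
  assumes "y \<le> s" "0 \<le> s" "s < 3"
  shows "exp y \<le> 1 + y + y\<^sup>2 / (2 * (1 - s / 3))"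
proof (cases "y \<le> 0")
  case True
  have "y\<^sup>2 / 2 \<le> y\<^sup>2 / (2 * (1 - s / 3))"
    using assms by (intro divide_left_mono) auto
  with exp_le_quadratic_nonpos[OF True] show ?thesis by linarith
next
  case False
  with assms have y: "0 \<le> y" "y < 3" by auto
  have "exp y \<le> (6 + 4 * y + y\<^sup>2) / (6 - 2 * y)"
    using exp_mult_le_quadratic_nonneg[OF y(1)] y by (simp add: field_simps)
  also have "\<dots> = 1 + y + y\<^sup>2 / (2 * (1 - y / 3))"
    using y by (simp add: field_simps power2_eq_square)
  also have "y\<^sup>2 / (2 * (1 - y / 3)) \<le> y\<^sup>2 / (2 * (1 - s / 3))"
    using assms y by (intro divide_left_mono) auto
  finally show ?thesis by simp
qed

text \<open>After centring at the mean \<open>m\<close>, the linear terms of the Bernstein bound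
  cancel and the quadratic ones add up to the variance \<open>(1 - p) * p * (a - b)\<^sup>2\<close>.
  The inequality \<open>1 + z \<le> exp z\<close> then gives the product form needed for
  iteration.\<close>

lemma two_point_exp_moment_le:
  fixes p a b c C l :: real
  assumes p: "0 \<le> p" "p \<le> 1" and ab: "\<bar>a - b\<bar> \<le> c" and "c \<le> C"
    and l: "0 \<le> l" "l * C < 3"
  shows "p * exp (l * a) + (1 - p) * exp (l * b) \<le>
    exp (l * (p * a + (1 - p) * b)) * exp (l\<^sup>2 / (2 * (1 - l * C / 3)) * ((1 - p) * p * c\<^sup>2))"
proof -
  define m where "m = p * a + (1 - p) * b"
  define K where "K = 1 / (2 * (1 - l * C / 3))"
  have "l * C / 3 < 1" using l(2) by simp
  then have K: "K \<ge> 0" unfolding K_def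
    by (intro divide_nonneg_nonneg mult_nonneg_nonneg) simp_all
  have C: "0 \<le> C" using ab \<open>c \<le> C\<close> by linarith
  have le: "exp (l * d) \<le> 1 + l * d + K * (l * d)\<^sup>2" if "d \<le> C" for d
    using exp_le_bernstein[of "l * d" "l * C"] l C that by (simp add: mult_left_mono K_def)
  have dev: "a - m = (1 - p) * (a - b)" "b - m = - (p * (a - b))"
    by (simp_all add: m_def algebra_simps)
  \<comment> \<open>Each deviation from the mean is a fraction of \<open>a - b\<close>, hence at
    most \<open>C\<close>, as \<open>le\<close> requires.\<close>
  have "\<bar>(1 - p) * (a - b)\<bar> \<le> \<bar>a - b\<bar>" "\<bar>p * (a - b)\<bar> \<le> \<bar>a - b\<bar>"
    using p by (simp_all add: abs_mult mult_left_le_one_le)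
  then have "a - m \<le> C" "b - m \<le> C" using ab \<open>c \<le> C\<close> unfolding dev by linarith+
  note bounds = le[OF this(1)] le[OF this(2)]
  have "p * exp (l * (a - m)) + (1 - p) * exp (l * (b - m))
    \<le> p * (1 + l * (a - m) + K * (l * (a - m))\<^sup>2) + (1 - p) * (1 + l * (b - m) + K * (l * (b - m))\<^sup>2)"
    using p bounds by (intro add_mono mult_left_mono) auto
  also have "\<dots> = 1 + K * l\<^sup>2 * ((1 - p) * p * (a - b)\<^sup>2)"
    unfolding dev by (simp add: algebra_simps power2_eq_square)
  also have "\<dots> \<le> 1 + K * l\<^sup>2 * ((1 - p) * p * c\<^sup>2)"
    using p K ab by (intro add_left_mono mult_left_mono) (auto simp: abs_le_square_iff[symmetric])
  also have "\<dots> \<le> exp (K * l\<^sup>2 * ((1 - p) * p * c\<^sup>2))"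
    by (rule exp_ge_add_one_self)
  finally have "exp (l * m) * (p * exp (l * (a - m)) + (1 - p) * exp (l * (b - m)))
    \<le> exp (l * m) * exp (K * l\<^sup>2 * ((1 - p) * p * c\<^sup>2))"
    by simp
  also have "exp (l * m) * (p * exp (l * (a - m)) + (1 - p) * exp (l * (b - m)))
      = p * exp (l * a) + (1 - p) * exp (l * b)"
    by (simp add: distrib_left right_diff_distrib exp_diff)
  finally show ?thesis by (simp add: m_def K_def)
qed

section \<open>Exponential moments and tails on the weighted cube\<close>

text \<open>The point mass of a product of Bernoulli laws. Finite weighted sums over the cube keep
  the induction on the coordinates free of measure theory.\<close>

definition bernoulli_weight :: "('i \<Rightarrow> real) \<Rightarrow> 'i set \<Rightarrow> ('i \<Rightarrow> real) \<Rightarrow> real" where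
  "bernoulli_weight p I x = (\<Prod>k\<in>I. if x k = 1 then p k else 1 - p k)"

lemma bernoulli_weight_nonneg:
  assumes "\<And>k. k \<in> I \<Longrightarrow> 0 \<le> p k \<and> p k \<le> 1"
  shows "0 \<le> bernoulli_weight p I x"
  unfolding bernoulli_weight_def using assms by (intro prod_nonneg) auto

text \<open>Fubini for one coordinate: the larger cube is the bijective image of
  \<open>{0, 1}\<close> times the smaller one under \<open>x(k := b)\<close>, and the weight factors
  accordingly.\<close>

lemma sum_bernoulli_weight_insert:
  fixes f :: "('i \<Rightarrow> real) \<Rightarrow> real"
  assumes "finite I" "k \<notin> I"
  shows "(\<Sum>x\<in>insert k I \<rightarrow>\<^sub>E {0, 1}. bernoulli_weight p (insert k I) x * f x) =
    (\<Sum>x\<in>I \<rightarrow>\<^sub>E {0, 1}. bernoulli_weight p I x * (p k * f (x(k := 1)) + (1 - p k) * f (x(k := 0))))"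
proof -
  let ?g = "\<lambda>(b, x). x(k := b)"
  have w: "bernoulli_weight p (insert k I) (x(k := b)) =
      (if b = 1 then p k else 1 - p k) * bernoulli_weight p I x" for x b
    unfolding bernoulli_weight_def using assms by (simp cong: prod.cong) (auto intro!: prod.cong)
  have "(\<Sum>x\<in>insert k I \<rightarrow>\<^sub>E {0, 1}. bernoulli_weight p (insert k I) x * f x) =
      (\<Sum>(b, x)\<in>{0, 1} \<times> (I \<rightarrow>\<^sub>E {0, 1}).
        bernoulli_weight p (insert k I) (x(k := b)) * f (x(k := b)))"
    unfolding PiE_insert_eq sum.reindex[OF inj_combinator[OF assms(2), of "\<lambda>_. {0, 1 :: real}"]]
    by (simp only: comp_def case_prod_unfold)
  also have "\<dots> = (\<Sum>x\<in>I \<rightarrow>\<^sub>E {0, 1}. \<Sum>b\<in>{0, 1}.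
        bernoulli_weight p (insert k I) (x(k := b)) * f (x(k := b)))"
    by (subst sum.cartesian_product[symmetric]) (rule sum.swap)
  also have "\<dots> = (\<Sum>x\<in>I \<rightarrow>\<^sub>E {0, 1}.
      bernoulli_weight p I x * (p k * f (x(k := 1)) + (1 - p k) * f (x(k := 0))))"
    by (intro sum.cong refl) (simp add: w algebra_simps)
  finally show ?thesis .
qed

text \<open>Induction on \<open>I\<close> with \<open>f\<close> arbitrary, since the induction
  hypothesis is applied to the average \<open>g\<close> of \<open>f\<close> over the new coordinate.
  Oscillations are stated through the updates to \<open>1\<close> and \<open>0\<close>, a form that
  such averaging inherits.\<close>

lemma bernoulli_exp_moment_le:
  fixes f :: "('i \<Rightarrow> real) \<Rightarrow> real" and p c :: "'i \<Rightarrow> real"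
  assumes "finite I"
    and "\<And>k. k \<in> I \<Longrightarrow> 0 \<le> p k \<and> p k \<le> 1"
    and "\<And>k. k \<in> I \<Longrightarrow> c k \<le> C"
    and l: "0 \<le> l" "l * C < 3"
    and "\<And>k x. k \<in> I \<Longrightarrow> x \<in> I \<rightarrow>\<^sub>E {0, 1} \<Longrightarrow> \<bar>f (x(k := 1)) - f (x(k := 0))\<bar> \<le> c k"
  shows "(\<Sum>x\<in>I \<rightarrow>\<^sub>E {0, 1}. bernoulli_weight p I x * exp (l * f x)) \<le>
    exp (l * (\<Sum>x\<in>I \<rightarrow>\<^sub>E {0, 1}. bernoulli_weight p I x * f x)) *
    exp (l\<^sup>2 / (2 * (1 - l * C / 3)) * (\<Sum>k\<in>I. (1 - p k) * p k * (c k)\<^sup>2))"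
  using assms(1-3,6)
proof (induction I arbitrary: f rule: finite_induct)
  case empty
  then show ?case by (simp add: bernoulli_weight_def)
next
  case (insert k I)
  define K where "K = l\<^sup>2 / (2 * (1 - l * C / 3))"
  define g where "g x = p k * f (x(k := 1)) + (1 - p k) * f (x(k := 0))" for x
  have pk: "0 \<le> p k" "p k \<le> 1" using insert.prems(1) by auto
  have upd: "x(k := b) \<in> insert k I \<rightarrow>\<^sub>E {0, 1}" if "x \<in> I \<rightarrow>\<^sub>E {0, 1}" "b \<in> {0, 1}" for x b
    using that by (rule PiE_fun_upd[rotated])
  \<comment> \<open>Updates at \<open>j\<close> and \<open>k\<close> commute, so the increment of
    \<open>g\<close> at \<open>j\<close> is a convex combination of two increments of
    \<open>f\<close> at \<open>j\<close>.\<close>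
  have osc_g: "\<bar>g (x(j := 1)) - g (x(j := 0))\<bar> \<le> c j" if j: "j \<in> I" and x: "x \<in> I \<rightarrow>\<^sub>E {0, 1}" for j x
  proof -
    have "j \<noteq> k" using j insert.hyps by auto
    then have bound: "\<bar>f (x(j := 1, k := b)) - f (x(j := 0, k := b))\<bar> \<le> c j" if "b \<in> {0, 1}" for b
      using insert.prems(3)[of j "x(k := b)"] j upd[OF x that] by (simp only: fun_upd_twist[OF \<open>j \<noteq> k\<close>] insert_iff simp_thms)
    have "\<bar>g (x(j := 1)) - g (x(j := 0))\<bar> =
        \<bar>p k * (f (x(j := 1, k := 1)) - f (x(j := 0, k := 1))) +
         (1 - p k) * (f (x(j := 1, k := 0)) - f (x(j := 0, k := 0)))\<bar>"
      by (simp add: g_def algebra_simps)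
    also have "\<dots> \<le> p k * \<bar>f (x(j := 1, k := 1)) - f (x(j := 0, k := 1))\<bar> +
         (1 - p k) * \<bar>f (x(j := 1, k := 0)) - f (x(j := 0, k := 0))\<bar>"
      using pk by (intro order_trans[OF abs_triangle_ineq]) (simp add: abs_mult)
    also have "\<dots> \<le> p k * c j + (1 - p k) * c j"
      using pk bound by (intro add_mono mult_left_mono) auto
    finally show ?thesis by (simp add: algebra_simps)
  qed
  have osc_k: "\<bar>f (x(k := 1)) - f (x(k := 0))\<bar> \<le> c k" if "x \<in> I \<rightarrow>\<^sub>E {0, 1}" for x
    using insert.prems(3)[of k "x(k := 0)"] upd[OF that, of 0]
    by (simp only: fun_upd_upd insert_iff simp_thms)
  have "(\<Sum>x\<in>insert k I \<rightarrow>\<^sub>E {0, 1}. bernoulli_weight p (insert k I) x * exp (l * f x)) =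
      (\<Sum>x\<in>I \<rightarrow>\<^sub>E {0, 1}. bernoulli_weight p I x *
        (p k * exp (l * f (x(k := 1))) + (1 - p k) * exp (l * f (x(k := 0)))))"
    by (rule sum_bernoulli_weight_insert[OF insert.hyps])
  \<comment> \<open>With the other coordinates fixed at \<open>x\<close>, the two-point bound
    applies to \<open>f (x(k := 1))\<close> and \<open>f (x(k := 0))\<close>, whose mean is
    \<open>g x\<close>.\<close>
  also have "\<dots> \<le> (\<Sum>x\<in>I \<rightarrow>\<^sub>E {0, 1}. bernoulli_weight p I x *
        (exp (l * g x) * exp (K * ((1 - p k) * p k * (c k)\<^sup>2))))"
    unfolding g_def K_def using insert.prems pk osc_k l
    by (intro sum_mono mult_left_mono two_point_exp_moment_le bernoulli_weight_nonneg) auto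
  also have "\<dots> = (\<Sum>x\<in>I \<rightarrow>\<^sub>E {0, 1}. bernoulli_weight p I x * exp (l * g x)) *
        exp (K * ((1 - p k) * p k * (c k)\<^sup>2))"
    by (simp add: sum_distrib_right mult.assoc)
  also have "\<dots> \<le> (exp (l * (\<Sum>x\<in>I \<rightarrow>\<^sub>E {0, 1}. bernoulli_weight p I x * g x)) *
      exp (K * (\<Sum>k\<in>I. (1 - p k) * p k * (c k)\<^sup>2))) * exp (K * ((1 - p k) * p k * (c k)\<^sup>2))"
    unfolding K_def using insert.prems(1,2) by (intro mult_right_mono insert.IH osc_g) auto
  \<comment> \<open>Averaging in stages leaves the mean unchanged, so \<open>g\<close> and
    \<open>f\<close> share it.\<close>
  also have "(\<Sum>x\<in>I \<rightarrow>\<^sub>E {0, 1}. bernoulli_weight p I x * g x) =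
      (\<Sum>x\<in>insert k I \<rightarrow>\<^sub>E {0, 1}. bernoulli_weight p (insert k I) x * f x)"
    unfolding g_def by (rule sum_bernoulli_weight_insert[OF insert.hyps, symmetric])
  finally show ?case
    using insert.hyps by (simp add: K_def distrib_left exp_add mult_ac)
qed

text \<open>Markov's inequality for \<open>exp (l * f x)\<close>, combined with the moment bound.
  The parameter \<open>l\<close> stays free, to be chosen according to the case at hand.\<close>

lemma bernoulli_tail_le:
  fixes f :: "('i \<Rightarrow> real) \<Rightarrow> real" and p c :: "'i \<Rightarrow> real" and I :: "'i set" and l C t :: real
  defines "m \<equiv> (\<Sum>x\<in>I \<rightarrow>\<^sub>E {0, 1}. bernoulli_weight p I x * f x)"
  assumes fin: "finite I"
    and p: "\<And>k. k \<in> I \<Longrightarrow> 0 \<le> p k \<and> p k \<le> 1"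
    and c: "\<And>k. k \<in> I \<Longrightarrow> c k \<le> C"
    and l: "0 \<le> l" "l * C < 3"
    and osc: "\<And>k x. k \<in> I \<Longrightarrow> x \<in> I \<rightarrow>\<^sub>E {0, 1} \<Longrightarrow> \<bar>f (x(k := 1)) - f (x(k := 0))\<bar> \<le> c k"
  shows "(\<Sum>x\<in>I \<rightarrow>\<^sub>E {0, 1}. bernoulli_weight p I x * of_bool (m + t \<le> f x)) \<le>
    exp (l\<^sup>2 / (2 * (1 - l * C / 3)) * (\<Sum>k\<in>I. (1 - p k) * p k * (c k)\<^sup>2) - l * t)"
proof -
  \<comment> \<open>If the event holds, the combined exponent \<open>l * (f x - (m + t))\<close> is
    nonnegative; otherwise the left side is \<open>0\<close>.\<close>
  have "of_bool (m + t \<le> f x) \<le> exp (l * f x) * exp (- (l * (m + t)))" for x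
  proof -
    have "exp (l * f x) * exp (- (l * (m + t))) = exp (l * (f x - (m + t)))"
      by (simp add: exp_add[symmetric] algebra_simps)
    then show ?thesis using l by (simp add: of_bool_def)
  qed
  then have "(\<Sum>x\<in>I \<rightarrow>\<^sub>E {0, 1}. bernoulli_weight p I x * of_bool (m + t \<le> f x)) \<le>
      (\<Sum>x\<in>I \<rightarrow>\<^sub>E {0, 1}. bernoulli_weight p I x * (exp (l * f x) * exp (- (l * (m + t)))))"
    using p by (intro sum_mono mult_left_mono bernoulli_weight_nonneg) auto
  also have "\<dots> = (\<Sum>x\<in>I \<rightarrow>\<^sub>E {0, 1}. bernoulli_weight p I x * exp (l * f x)) * exp (- (l * (m + t)))"
    by (simp add: sum_distrib_right mult.assoc)
  also have "\<dots> \<le> exp (l * m) * exp (l\<^sup>2 / (2 * (1 - l * C / 3)) *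
      (\<Sum>k\<in>I. (1 - p k) * p k * (c k)\<^sup>2)) * exp (- (l * (m + t)))"
    unfolding m_def using assms by (intro mult_right_mono bernoulli_exp_moment_le) auto
  also have "\<dots> = exp (l\<^sup>2 / (2 * (1 - l * C / 3)) * (\<Sum>k\<in>I. (1 - p k) * p k * (c k)\<^sup>2) - l * t)"
    by (simp add: exp_add[symmetric] algebra_simps)
  finally show ?thesis .
qed

section \<open>From independent random variables to the weighted cube\<close>

text \<open>Pointwise, \<open>h\<close> of the random vector is the sum over \<open>x\<close> of
  \<open>h x\<close> times the product of the indicators of \<open>X k = x k\<close>. Independence
  turns the expectation of each product into a product of expectations, which is the weight of
  \<open>x\<close>.\<close>

lemma (in prob_space) expectation_bernoulli_vector:
  fixes X :: "'i \<Rightarrow> 'a \<Rightarrow> real" and h :: "('i \<Rightarrow> real) \<Rightarrow> real"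
  assumes fin: "finite I" and ind: "indep_vars (\<lambda>_. borel) X I"
    and X01: "\<And>k \<omega>. k \<in> I \<Longrightarrow> \<omega> \<in> space M \<Longrightarrow> X k \<omega> \<in> {0, 1}"
  shows "expectation (\<lambda>\<omega>. h (\<lambda>k\<in>I. X k \<omega>)) =
    (\<Sum>x\<in>I \<rightarrow>\<^sub>E {0, 1}. bernoulli_weight (\<lambda>k. prob {\<omega> \<in> space M. X k \<omega> = 1}) I x * h x)"
proof -
  define Y where "Y x k \<omega> = (of_bool (X k \<omega> = x k) :: real)" for x k \<omega>
  have rv [measurable]: "random_variable borel (X k)" if "k \<in> I" for k
    using ind that by (auto simp: indep_vars_def)
  have indY: "indep_vars (\<lambda>_. borel) (Y x) I" for x
    unfolding Y_def using ind by (rule indep_vars_compose2) simp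
  have intY: "integrable M (Y x k)" if "k \<in> I" for x k
    unfolding Y_def using that by (intro integrable_const_bound[where B = 1]) auto
  have EY1: "expectation (\<lambda>\<omega>. of_bool (X k \<omega> = 1)) = prob {\<omega> \<in> space M. X k \<omega> = 1}" if "k \<in> I" for k
  proof -
    have "expectation (\<lambda>\<omega>. of_bool (X k \<omega> = 1)) =
        expectation (indicator {\<omega> \<in> space M. X k \<omega> = 1})"
      by (intro Bochner_Integration.integral_cong) (auto simp: indicator_def)
    also have "\<dots> = prob ({\<omega> \<in> space M. X k \<omega> = 1} \<inter> space M)"
      by (rule Bochner_Integration.integral_indicator)
    also have "{\<omega> \<in> space M. X k \<omega> = 1} \<inter> space M = {\<omega> \<in> space M. X k \<omega> = 1}" by auto
    finally show ?thesis .
  qed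
  have EY: "expectation (Y x k) = (if x k = 1 then prob {\<omega> \<in> space M. X k \<omega> = 1}
      else 1 - prob {\<omega> \<in> space M. X k \<omega> = 1})" if "k \<in> I" "x \<in> I \<rightarrow>\<^sub>E {0, 1}" for x k
  proof (cases "x k = 1")
    case True
    then show ?thesis using EY1[OF that(1)] by (simp add: Y_def[abs_def])
  next
    case False
    then have "x k = 0" using that by auto
    \<comment> \<open>As \<open>X k\<close> takes only the values \<open>0\<close> and
      \<open>1\<close>, the indicators of the two values add up to \<open>1\<close>.\<close>
    then have "expectation (Y x k) = expectation (\<lambda>\<omega>. 1 - of_bool (X k \<omega> = 1))"
      unfolding Y_def using X01[OF that(1)] by (intro Bochner_Integration.integral_cong) auto
    also have "\<dots> = 1 - expectation (\<lambda>\<omega>. of_bool (X k \<omega> = 1))"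
      using intY[OF that(1), of "\<lambda>_. 1"]
      by (subst Bochner_Integration.integral_diff) (auto simp: Y_def[abs_def] prob_space)
    finally show ?thesis using False EY1[OF that(1)] by simp
  qed
  have prodY: "integrable M (\<lambda>\<omega>. \<Prod>k\<in>I. Y x k \<omega>) \<and>
      expectation (\<lambda>\<omega>. \<Prod>k\<in>I. Y x k \<omega>) = (\<Prod>k\<in>I. expectation (Y x k))" for x
    using indep_vars_integrable[OF fin indY intY] indep_vars_lebesgue_integral[OF fin indY intY]
    by blast
  have "expectation (\<lambda>\<omega>. h (\<lambda>k\<in>I. X k \<omega>)) =
      expectation (\<lambda>\<omega>. \<Sum>x\<in>I \<rightarrow>\<^sub>E {0, 1}. h x * (\<Prod>k\<in>I. Y x k \<omega>))"
  proof (intro Bochner_Integration.integral_cong refl)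
    fix \<omega> assume \<omega>: "\<omega> \<in> space M"
    let ?x = "\<lambda>k\<in>I. X k \<omega>"
    have x: "?x \<in> I \<rightarrow>\<^sub>E {0, 1}" using X01[OF _ \<omega>] by auto
    \<comment> \<open>Extensional functions that differ do so at some index in \<open>I\<close>, and
      the factor there is \<open>0\<close>.\<close>
    have "(\<Prod>k\<in>I. Y x k \<omega>) = of_bool (x = ?x)" if xI: "x \<in> I \<rightarrow>\<^sub>E {0, 1}" for x
    proof (cases "x = ?x")
      case False
      then obtain k where "k \<in> I" "x k \<noteq> ?x k"
        using PiE_ext[OF xI x] by blast
      then have "Y x k \<omega> = 0" by (auto simp: Y_def)
      with \<open>k \<in> I\<close> fin False show ?thesis by (auto intro: prod_zero)
    next
      case True
      then have "Y x k \<omega> = 1" if "k \<in> I" for k using that by (simp add: Y_def)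
      with True show ?thesis by simp
    qed
    then have "(\<Sum>x\<in>I \<rightarrow>\<^sub>E {0, 1}. h x * (\<Prod>k\<in>I. Y x k \<omega>)) =
        (\<Sum>x\<in>I \<rightarrow>\<^sub>E {0, 1}. if x = ?x then h x else 0)"
      by (intro sum.cong refl) simp
    also have "\<dots> = (if ?x \<in> I \<rightarrow>\<^sub>E {0, 1} then h ?x else 0)"
      using fin by (intro sum.delta finite_PiE) auto
    also have "\<dots> = h ?x" using x by (simp only: if_True)
    finally show "h ?x = (\<Sum>x\<in>I \<rightarrow>\<^sub>E {0, 1}. h x * (\<Prod>k\<in>I. Y x k \<omega>))" ..
  qed
  also have "\<dots> = (\<Sum>x\<in>I \<rightarrow>\<^sub>E {0, 1}. h x * (\<Prod>k\<in>I. expectation (Y x k)))"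
    using prodY by (subst Bochner_Integration.integral_sum) auto
  also have "\<dots> = (\<Sum>x\<in>I \<rightarrow>\<^sub>E {0, 1}. bernoulli_weight (\<lambda>k. prob {\<omega> \<in> space M. X k \<omega> = 1}) I x * h x)"
    unfolding bernoulli_weight_def by (intro sum.cong refl) (simp add: EY mult.commute)
  finally show ?thesis .
qed

section \<open>Choice of the parameter and degenerate cases\<close>

theorem corollary6:
  fixes M :: "'a measure"
    and N :: nat
    and X :: "nat \<Rightarrow> 'a \<Rightarrow> real"
    and p c :: "nat \<Rightarrow> real"
    and f :: "(nat \<Rightarrow> real) \<Rightarrow> real"
    and \<mu> C t :: real
  assumes "prob_space M"
    and "prob_space.indep_vars M (\<lambda>_. borel) X {1..N}"
    and "\<And>k \<omega>. k \<in> {1..N} \<Longrightarrow> \<omega> \<in> space M \<Longrightarrow> X k \<omega> \<in> {0, 1}"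
    and "\<And>k. k \<in> {1..N} \<Longrightarrow> p k = measure M {\<omega> \<in> space M. X k \<omega> = 1}"
    and "\<And>k x y. k \<in> {1..N} \<Longrightarrow> x \<in> binary_cube N \<Longrightarrow> y \<in> binary_cube N \<Longrightarrow>
           differ_only_at N k x y \<Longrightarrow> \<bar>f x - f y\<bar> \<le> c k"
    and "\<mu> = integral\<^sup>L M (\<lambda>\<omega>. f (random_vector N X \<omega>))"
    and "C = Max (c ` {1..N})"
    and "t \<ge> 0"
  shows "measure M {\<omega> \<in> space M. f (random_vector N X \<omega>) \<ge> \<mu> + t}
           \<le> exp (- (t\<^sup>2 / (2 * (\<Sum>k\<in>{1..N}. (1 - p k) * p k * (c k)\<^sup>2) + 2 * C * t / 3)))"
proof -
  interpret prob_space M by fact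
  define I where "I = {1..N}"
  define V where "V = (\<Sum>k\<in>I. (1 - p k) * p k * (c k)\<^sup>2)"
  define P where "P = measure M {\<omega> \<in> space M. f (random_vector N X \<omega>) \<ge> \<mu> + t}"
  have fin: "finite I" by (simp add: I_def)
  have p01: "0 \<le> p k \<and> p k \<le> 1" if "k \<in> I" for k
    using assms(4) that by (simp add: I_def)
  have V0: "0 \<le> V" unfolding V_def using p01 by (intro sum_nonneg) auto
  have cC: "c k \<le> C" if "k \<in> I" for k
    using assms(7) that by (auto simp: I_def)
  \<comment> \<open>The two updates of a cube point stay in the cube and differ exactly at
    \<open>k\<close>, so the bounded difference assumption applies to them.\<close>
  have osc: "\<bar>f (x(k := 1)) - f (x(k := 0))\<bar> \<le> c k" if "k \<in> I" "x \<in> I \<rightarrow>\<^sub>E {0, 1}" for k x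
  proof (rule assms(5))
    show "k \<in> {1..N}" using that by (simp add: I_def)
    have "x(k := b) \<in> I \<rightarrow>\<^sub>E {0, 1}" if "b \<in> {0, 1}" for b
      using PiE_fun_upd[of b "\<lambda>_. {0, 1}" k, OF that \<open>x \<in> _\<close>] by (simp only: insert_absorb[OF \<open>k \<in> I\<close>])
    then show "x(k := 1) \<in> binary_cube N" "x(k := 0) \<in> binary_cube N"
      unfolding binary_cube_def I_def by blast+
    show "differ_only_at N k (x(k := 1)) (x(k := 0))"
      using that by (auto simp: differ_only_at_def I_def)
  qed
  have weight: "bernoulli_weight (\<lambda>k. prob {\<omega> \<in> space M. X k \<omega> = 1}) I x = bernoulli_weight p I x" for x
    unfolding bernoulli_weight_def using assms(4) by (intro prod.cong) (auto simp: I_def)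
  \<comment> \<open>Stated for every \<open>h\<close>: it is used with \<open>f\<close> for the mean
    and with the indicator of the tail event for \<open>P\<close>.\<close>
  have E: "expectation (\<lambda>\<omega>. h (random_vector N X \<omega>)) =
      (\<Sum>x\<in>I \<rightarrow>\<^sub>E {0, 1}. bernoulli_weight p I x * h x)" for h
    unfolding random_vector_def weight[symmetric] unfolding I_def
    by (rule expectation_bernoulli_vector[where h = h, OF finite_atLeastAtMost assms(2,3)])
  define m where "m = (\<Sum>x\<in>I \<rightarrow>\<^sub>E {0, 1}. bernoulli_weight p I x * f x)"
  have m: "\<mu> = m" using assms(6) E[of f] by (simp add: m_def)
  have "P = expectation (\<lambda>\<omega>. of_bool (\<mu> + t \<le> f (random_vector N X \<omega>)))"
  proof -
    have "expectation (\<lambda>\<omega>. of_bool (\<mu> + t \<le> f (random_vector N X \<omega>)) :: real) =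
        expectation (indicator {\<omega> \<in> space M. f (random_vector N X \<omega>) \<ge> \<mu> + t})"
      by (intro Bochner_Integration.integral_cong) (auto simp: indicator_def)
    also have "\<dots> = prob ({\<omega> \<in> space M. f (random_vector N X \<omega>) \<ge> \<mu> + t} \<inter> space M)"
      by (rule Bochner_Integration.integral_indicator)
    also have "{\<omega> \<in> space M. f (random_vector N X \<omega>) \<ge> \<mu> + t} \<inter> space M =
        {\<omega> \<in> space M. f (random_vector N X \<omega>) \<ge> \<mu> + t}" by auto
    also have "prob \<dots> = P" by (rule P_def[symmetric])
    finally show ?thesis ..
  qed
  also have "\<dots> = (\<Sum>x\<in>I \<rightarrow>\<^sub>E {0, 1}. bernoulli_weight p I x * of_bool (m + t \<le> f x))"
    unfolding m by (rule E[of "\<lambda>x. of_bool (m + t \<le> f x)"])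
  finally have chernoff: "P \<le> exp (l\<^sup>2 / (2 * (1 - l * C / 3)) * V - l * t)"
    if "0 \<le> l" "l * C < 3" for l
    using bernoulli_tail_le[of I p c C l f t, OF fin p01 cC that osc]
    by (simp add: V_def m_def)
  have "P \<le> exp (- (t\<^sup>2 / (2 * V + 2 * C * t / 3)))"
  proof (cases "t = 0 \<or> N = 0")
    case True
    show ?thesis
    proof (cases "t = 0")
      case False
      with True have "N = 0" by simp
      \<comment> \<open>Without coordinates the vector is constant, so \<open>f\<close> equals its
        mean and the event is empty for \<open>t > 0\<close>. This covers the case where
        \<open>C\<close> is the unspecified maximum of the empty set.\<close>
      then have rv: "random_vector N X \<omega> = (\<lambda>_. undefined)" for \<omega>
        by (simp add: random_vector_def restrict_def)
      then have "\<mu> = f (\<lambda>_. undefined)" using assms(6) by (simp add: prob_space)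
      then show ?thesis using False assms(8) by (simp add: P_def rv)
    qed (simp add: P_def)
  next
    case False
    then have t: "t > 0" and N: "1 \<in> I" using assms(8) by (auto simp: I_def)
    \<comment> \<open>Any point of the cube yields \<open>0 \<le> c k\<close> through
      \<open>osc\<close>; the zero vector serves as witness.\<close>
    have "(\<lambda>k\<in>I. 0) \<in> I \<rightarrow>\<^sub>E {0, 1 :: real}" by auto
    from osc[OF N this] cC[OF N] have C0: "0 \<le> C" by linarith
    show ?thesis
    proof (cases "C = 0 \<or> V = 0")
      case deg: True
      show ?thesis
      proof (cases "C = 0")
        case True
        \<comment> \<open>Here all \<open>c k\<close> are squeezed to \<open>0\<close>, so the
          denominator is \<open>0\<close>. Since division by zero yields \<open>0\<close>, the
          claimed bound is \<open>1\<close>.\<close>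
        have "c k = 0" if "k \<in> I" for k
          using osc[OF that \<open>(\<lambda>k\<in>I. 0) \<in> _\<close>] cC[OF that] True by linarith
        then have "V = 0" by (simp add: V_def)
        with True show ?thesis by (simp add: P_def)
      next
        case False
        with deg C0 have "V = 0" "C > 0" by auto
        \<comment> \<open>With \<open>V = 0\<close> the parameter \<open>t / (V + C * t / 3)\<close>
          would be \<open>3 / C\<close>, violating \<open>l * C < 3\<close>. Half of it is
          admissible and gives \<open>l * t = 3 * t / (2 * C)\<close>, exactly the claimed exponent
          up to sign.\<close>
        then show ?thesis using chernoff[of "3 / (2 * C)"] t
          by (simp add: power2_eq_square mult.commute)
      qed
    next
      case False
      with V0 C0 have pos: "V > 0" "C > 0" by auto
      \<comment> \<open>The parameter is \<open>l = t / D\<close>, and \<open>2 * D\<close> is the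
        denominator of the claim. As \<open>1 - l * C / 3 = V / D\<close>, the exponent becomes
        \<open>t\<^sup>2 / (2 * D) - t\<^sup>2 / D\<close>.\<close>
      define D where "D = V + C * t / 3"
      have D: "D > 0" using pos t by (simp add: D_def add_pos_pos)
      have DV: "1 - t / D * C / 3 = V / D"
        using D by (simp add: D_def field_simps)
      have "P \<le> exp ((t / D)\<^sup>2 / (2 * (1 - t / D * C / 3)) * V - t / D * t)"
      proof (rule chernoff)
        \<comment> \<open>The gap is \<open>3 * V\<close>, so positivity of \<open>V\<close> makes
          the parameter admissible.\<close>
        have "t * C < 3 * D" using pos by (simp add: D_def mult.commute)
        then show "t / D * C < 3" using D by (simp add: pos_divide_less_eq)
      qed (use t D in simp)
      also have "(t / D)\<^sup>2 / (2 * (1 - t / D * C / 3)) * V - t / D * t = - (t\<^sup>2 / (2 * D))"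
        unfolding DV using D pos by (simp add: field_simps power2_eq_square)
      finally show ?thesis by (simp add: D_def algebra_simps)
    qed
  qed
  then show ?thesis by (simp add: P_def V_def I_def)
qed

end
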